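(* Let $T$ be a real task with raw submission set $\Omega$, admissible submission set $\Pi\subseteq\Omega$ and evaluator $E_T:\Omega\to\mathbb{R}^d$, let $\Pi_{\mathrm{AI}}(T)\subseteq\Pi$ be a finite nonempty declared AI-native baseline, and let $F_{\mathrm{AI}}(T)=\operatorname{PF}(S_{\mathrm{AI}}(T))$ be the declared AI-native frontier. Let $g_{\mathrm{AI}}\in\mathbb{R}$, let $\phi:\mathbb{R}_{\ge 0}\to\mathbb{R}_{\ge 0}$ be monotone with $\phi(0)=0$, and let the Pareto-surplus grade be \[ G_T(\pi)=g_{\mathrm{AI}}+\phi(\delta_T(\pi)),\qquad \pi\in\Omega . \] Then: 1. every AI-native submission $\pi\in\Pi_{\mathrm{AI}}(T)$ receives surplus grade exactly $G_T(\pi)=g_{\mathrm{AI}}$; 2. every submission $\pi\in\Omega$ with $G_T(\pi)>g_{\mathrm{AI}}$ has positive Pareto surplus beyond $F_{\mathrm{AI}}(T)$, i.e. $\delta_T(\pi)>0$.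
   Context: Let $d\ge 1$. For $x,y\in\mathbb{R}^d$, $x\preceq y$ means $x_i\le y_i$ for every $i$; $x\prec y$ means $x\preceq y$ and $x_j<y_j$ for at least one $j$. For a finite set $S\subset\mathbb{R}^d$, the Pareto frontier is $\operatorname{PF}(S)=\{s\in S:\text{there is no } s'\in S \text{ with } s\prec s'\}$. For a finite set $F\subset\mathbb{R}^d$ and $r\in\mathbb{R}^d$, the dominated hypervolume is \[ \operatorname{HV}(F;r)=\lambda_d\Big(\bigcup_{s\in F}[r_1,s_1]\times\cdots\times[r_d,s_d]\Big), \] with $\lambda_d$ Lebesgue measure on $\mathbb{R}^d$. Real task (abstractly): a set $\Omega$ of raw submissions, a subset $\Pi\subseteq\Omega$ of admissible submissions, and a total evaluator $E_T:\Omega\to\mathbb{R}^d$ (larger coordinates are better), equal to a fixed failing score on $\Omega\setminus\Pi$. A bounded box of nonfailing scores and a reference point $r\in\mathbb{R}^d$ strictly dominated by every point of that box are fixed in advance; nonfailing scores lie in the box. The score set of the AI-native baseline is $S_{\mathrm{AI}}(T)=\{E_T(\pi):\pi\in\Pi_{\mathrm{AI}}(T)\}$. Pareto surplus: for admissible $\pi\in\Pi$, $\delta_T(\pi)=\operatorname{HV}(F_{\mathrm{AI}}(T)\cup\{E_T(\pi)\};r)-\operatorname{HV}(F_{\mathrm{AI}}(T);r)$; for nonadmissible $\pi\in\Omega\setminus\Pi$, $\delta_T(\pi)=0$. *)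

theory Defs
  imports "HOL-Analysis.Analysis"
begin

text \<open>On \<^typ>\<open>real ^ 'd\<close> the library order \<open>\<le>\<close> is the componentwise one.\<close>

definition pareto_less :: "real ^ 'd \<Rightarrow> real ^ 'd \<Rightarrow> bool"  (infix "\<prec>" 50) where
  "x \<prec> y \<longleftrightarrow> x \<le> y \<and> (\<exists>j. x $ j < y $ j)"

definition pareto_frontier :: "(real ^ 'd) set \<Rightarrow> (real ^ 'd) set" where
  "pareto_frontier S = {s \<in> S. \<not> (\<exists>s'\<in>S. s \<prec> s')}"

text \<open>The box \<^term>\<open>cbox r s\<close> is empty when some \<^term>\<open>s $ i\<close> lies below \<^term>\<open>r $ i\<close>, so such
  points contribute nothing to the hypervolume.\<close>

definition hypervolume :: "(real ^ 'd) set \<Rightarrow> real ^ 'd \<Rightarrow> real" where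
  "hypervolume F r = measure lebesgue (\<Union>s\<in>F. cbox r s)"

record ('a, 'd) task =
  submissions :: "'a set"
  admissible :: "'a set"
  evaluator :: "'a \<Rightarrow> real ^ 'd"
  failing_score :: "real ^ 'd"
  score_box :: "(real ^ 'd) set"
  ref_point :: "real ^ 'd"

text \<open>In Euclidean space the sets satisfying \<^const>\<open>is_interval\<close> are exactly the products of real
  intervals (open, closed or half-open in each coordinate).\<close>

definition real_task :: "('a, 'd::finite) task \<Rightarrow> bool" where
  "real_task T \<longleftrightarrow>
     admissible T \<subseteq> submissions T \<and>
     (\<forall>p \<in> submissions T - admissible T. evaluator T p = failing_score T) \<and>
     is_interval (score_box T) \<and> bounded (score_box T) \<and>
     (\<forall>b \<in> score_box T. ref_point T \<prec> b) \<and>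
     (\<forall>p \<in> submissions T. evaluator T p \<noteq> failing_score T \<longrightarrow> evaluator T p \<in> score_box T)"

definition ai_scores :: "('a, 'd::finite) task \<Rightarrow> 'a set \<Rightarrow> (real ^ 'd) set" where
  "ai_scores T A = evaluator T ` A"

definition ai_frontier :: "('a, 'd::finite) task \<Rightarrow> 'a set \<Rightarrow> (real ^ 'd) set" where
  "ai_frontier T A = pareto_frontier (ai_scores T A)"

definition pareto_surplus :: "('a, 'd::finite) task \<Rightarrow> 'a set \<Rightarrow> 'a \<Rightarrow> real" where
  "pareto_surplus T A p =
     (if p \<in> admissible T
      then hypervolume (ai_frontier T A \<union> {evaluator T p}) (ref_point T)
           - hypervolume (ai_frontier T A) (ref_point T)
      else 0)"

definition surplus_grade ::
    "('a, 'd::finite) task \<Rightarrow> 'a set \<Rightarrow> real \<Rightarrow> (real \<Rightarrow> real) \<Rightarrow> 'a \<Rightarrow> real" where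
  "surplus_grade T A g \<phi> p = g + \<phi> (pareto_surplus T A p)"

end

theory Submission
  imports Defs
begin

text \<open>A baseline score lies below some frontier point, so its box is contained in one already
  counted; adding it leaves the union unchanged, the surplus is 0, and \<open>\<phi> 0 = 0\<close>
  gives the grade \<open>g\<close> (\<open>pareto_surplus_baseline\<close>). Conversely, enlarging a
  finite set cannot shrink the hypervolume, so the surplus is never negative
  (\<open>pareto_surplus_nonneg\<close>); a grade other than \<open>g\<close> rules out surplus 0
  and hence forces it to be positive.\<close>

lemma pareto_less_iff_less: "pareto_less x y \<longleftrightarrow> x < y"
  by (auto simp: pareto_less_def less_vec_def less_eq_vec_def not_le)

text \<open>In a finite set every element has a maximal element above it, and by
  \<open>pareto_less_iff_less\<close> maximality for the library order is membership in the
  frontier.\<close>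

lemma pareto_frontier_dominates:
  assumes "finite S" and "s \<in> S"
  obtains t where "t \<in> pareto_frontier S" and "s \<le> t"
proof -
  obtain t where "t \<in> S" "s \<le> t" "\<forall>b\<in>S. t \<le> b \<longrightarrow> t = b"
    using finite_has_maximal2[OF assms] by blast
  then have "t \<in> pareto_frontier S"
    by (auto simp: pareto_frontier_def pareto_less_iff_less less_le)
  with \<open>s \<le> t\<close> show thesis by (rule that[rotated])
qed

text \<open>Boxes with the common lower corner \<open>r\<close> are nested when their upper corners
  are ordered, also when the smaller box is empty.\<close>

lemma hypervolume_insert_dominated:
  assumes "t \<in> F" and "s \<le> t"
  shows "hypervolume (F \<union> {s}) r = hypervolume F r"
proof -
  have "cbox r s \<subseteq> cbox r t"
    using assms(2) by (auto simp: mem_box_cart less_eq_vec_def) (meson order_trans)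
  then have "(\<Union>x\<in>F \<union> {s}. cbox r x) = (\<Union>x\<in>F. cbox r x)"
    using assms(1) by blast
  then show ?thesis by (simp only: hypervolume_def)
qed

text \<open>The real-valued \<open>measure\<close> is 0 on sets of infinite measure, so monotonicity
  rests on the larger union being a finite union of bounded boxes.\<close>

lemma hypervolume_mono:
  assumes "finite G" and "F \<subseteq> G"
  shows "hypervolume F r \<le> hypervolume G r"
  unfolding hypervolume_def
proof (rule measure_mono_fmeasurable)
  show "(\<Union>s\<in>F. cbox r s) \<subseteq> (\<Union>s\<in>G. cbox r s)"
    using assms(2) by blast
  show "(\<Union>s\<in>F. cbox r s) \<in> sets lebesgue"
    using finite_subset[OF assms(2,1)] by (intro sets.finite_UN) auto
  show "(\<Union>s\<in>G. cbox r s) \<in> lmeasurable"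
    using assms(1) by (intro fmeasurable.finite_UN) auto
qed

lemma finite_ai_frontier: "finite A \<Longrightarrow> finite (ai_frontier T A)"
  by (simp add: ai_frontier_def pareto_frontier_def ai_scores_def)

lemma pareto_surplus_nonneg:
  assumes "finite A"
  shows "pareto_surplus T A p \<ge> 0"
  using assms by (auto simp: pareto_surplus_def finite_ai_frontier intro!: hypervolume_mono)

lemma pareto_surplus_baseline:
  assumes "finite A" and "p \<in> A"
  shows "pareto_surplus T A p = 0"
proof -
  have "finite (ai_scores T A)" "evaluator T p \<in> ai_scores T A"
    using assms by (auto simp: ai_scores_def)
  then obtain t where "t \<in> ai_frontier T A" "evaluator T p \<le> t"
    unfolding ai_frontier_def by (rule pareto_frontier_dominates)
  then show ?thesis
    \<comment> \<open>Both branches of the definition vanish: the two hypervolumes coincide by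
      domination, and the other branch is 0 outright.\<close>
    unfolding pareto_surplus_def by (simp only: hypervolume_insert_dominated) simp
qed

theorem theorem2:
  fixes T :: "('a, 'd::finite) task"
    and A :: "'a set"
    and g :: real
    and \<phi> :: "real \<Rightarrow> real"
  assumes "real_task T"
    and "A \<subseteq> admissible T" and "finite A" and "A \<noteq> {}"
    and "\<phi> \<in> {0..} \<rightarrow> {0..}" and "mono_on {0..} \<phi>" and "\<phi> 0 = 0"
  shows "(\<forall>p\<in>A. surplus_grade T A g \<phi> p = g) \<and>
         (\<forall>p\<in>submissions T. surplus_grade T A g \<phi> p > g \<longrightarrow> pareto_surplus T A p > 0)"
proof (intro conjI ballI impI)
  fix p assume "p \<in> A"
  then show "surplus_grade T A g \<phi> p = g"
    using assms(3,7) by (simp add: surplus_grade_def pareto_surplus_baseline)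
next
  fix p assume "surplus_grade T A g \<phi> p > g"
  then have "pareto_surplus T A p \<noteq> 0"
    using assms(7) by (auto simp: surplus_grade_def)
  then show "pareto_surplus T A p > 0"
    using pareto_surplus_nonneg[OF assms(3), of T p] by linarith
qed

end
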